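(* Let $(X,d)$ be a metric space with at least two points. Then there exists a bounded metric $d'$ on $X$, equivalent to $d$, which is not sleek for $X$.
   Context: Two metrics on $X$ are equivalent if they induce the same topology. For a metric $d$ on $X$, $x\in X$ and $r>0$, let $B_d(x,r)=\{y\in X: d(x,y)<r\}$ and $B_d[x,r]=\{y\in X: d(x,y)\le r\}$ be the open and closed balls, and let $B_d^\circ[x,r]$ be the interior of $B_d[x,r]$ in $X$. The metric $d$ is sleek for $X$ if $B_d^\circ[x,r]=B_d(x,r)$ for all $x\in X$ and all $r>0$. *)

theory Defs
  imports "HOL-Analysis.Analysis"
begin

definition equivalent_metrics :: "'a set \<Rightarrow> ('a \<Rightarrow> 'a \<Rightarrow> real) \<Rightarrow> ('a \<Rightarrow> 'a \<Rightarrow> real) \<Rightarrow> bool" where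
  "equivalent_metrics X d d' \<longleftrightarrow> Metric_space.mtopology X d = Metric_space.mtopology X d'"

definition sleek :: "'a set \<Rightarrow> ('a \<Rightarrow> 'a \<Rightarrow> real) \<Rightarrow> bool" where
  "sleek X d \<longleftrightarrow>
    (\<forall>x\<in>X. \<forall>r>0. Metric_space.mtopology X d interior_of Metric_space.mcball X d x r
                = Metric_space.mball X d x r)"

end

theory Submission
  imports Defs
begin

text \<open>
  Cap the metric at the distance \<open>r\<close> of two distinct points \<open>p\<close> and \<open>q\<close>.
  Capping keeps the topology, since small balls are unchanged, but now every point lies within
  distance \<open>r\<close> of \<open>p\<close>. So the closed ball of radius \<open>r\<close> about \<open>p\<close> is the whole space, which
  is bounded and its own interior, whereas the open ball of the same radius omits \<open>q\<close>.
\<close>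

theorem theorem10:
  fixes X :: "'a set" and d :: "'a \<Rightarrow> 'a \<Rightarrow> real"
  assumes "Metric_space X d"
    and "\<exists>x\<in>X. \<exists>y\<in>X. x \<noteq> y"
  shows "\<exists>d'. Metric_space X d' \<and> Metric_space.mbounded X d' X
           \<and> equivalent_metrics X d d' \<and> \<not> sleek X d'"
proof -
  interpret Metric_space X d by fact
  obtain p q where pq: "p \<in> X" "q \<in> X" "p \<noteq> q"
    using assms(2) by blast
  define r where "r = d p q"
  have "r > 0"
    using pq by (simp add: r_def)
  interpret Cap: Metric_space X "capped_dist r"
    by (rule capped_dist)
  have "capped_dist r p x \<le> r" for x
    using \<open>r > 0\<close> by (simp add: capped_dist_def)
  then have ball: "Cap.mcball p r = X"
    using pq by auto
  have "Cap.mbounded X"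
    unfolding Cap.mbounded_def using ball by blast
  moreover have "equivalent_metrics X d (capped_dist r)"
    by (simp add: equivalent_metrics_def mtopology_capped_metric)
  moreover have "\<not> sleek X (capped_dist r)"
  proof
    assume "sleek X (capped_dist r)"
    then have "Cap.mtopology interior_of Cap.mcball p r = Cap.mball p r"
      using pq \<open>r > 0\<close> by (simp add: sleek_def)
    moreover have "Cap.mtopology interior_of X = X"
      using interior_of_topspace[of Cap.mtopology] by simp
    ultimately have "q \<in> Cap.mball p r"
      using pq ball by simp
    then have "capped_dist r p q < r"
      by simp
    then show False
      by (simp add: capped_dist_def r_def split: if_splits)
  qed
  ultimately show ?thesis
    using Cap.Metric_space_axioms by blast
qed

end
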